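(* Let $a,b\in\mathbb{Z}$ be such that the polynomial $f(x)=x^8+ax^6+bx^4+ax^2+1$ is monogenic, let $\alpha$ be a root of $f$, and let $K=\mathbb{Q}(\alpha)$. Put $m=a^2-4b+8$, and assume that $m<0$ and that $m$ is square-free. Let $\delta=\alpha^2+\alpha^{-2}\in K$, let $\sqrt{m}$ denote the square root of $m$ in $K$ for which $\delta=\frac{-a+\sqrt{m}}{2}$, that is, $\sqrt{m}=2\delta+a$, and let $\omega=\frac{1+\sqrt{m}}{2}$. Then $$\gamma=\left(\frac{a+1}{2}-\omega\right)\alpha+\alpha^3$$ generates a power integral basis in $K$.
   Context: For a number field $K$ of degree $n$ with ring of integers $\mathbb{Z}_K$, an element $\xi\in\mathbb{Z}_K$ generates a power integral basis in $K$ if $(1,\xi,\ldots,\xi^{n-1})$ is a $\mathbb{Z}$-basis of $\mathbb{Z}_K$, i.e. $\mathbb{Z}_K=\mathbb{Z}[\xi]$ (equivalently, the index $I(\xi)=(\mathbb{Z}_K:\mathbb{Z}[\xi])$ equals $1$). A monic polynomial $f(x)\in\mathbb{Z}[x]$ is called monogenic if it is irreducible over $\mathbb{Q}$ and a root $\xi$ of $f$ generates a power integral basis in $\mathbb{Q}(\xi)$. For $f(x)=x^8+ax^6+bx^4+ax^2+1$ and a root $\alpha$ of $f$, the element $\delta=\alpha^2+\alpha^{-2}$ satisfies $\delta^2+a\delta+(b-2)=0$, so $(2\delta+a)^2=a^2-4b+8=m$, and $\alpha$ satisfies $\alpha^4-\delta\alpha^2+1=0$. The field $M=\mathbb{Q}(\delta)=\mathbb{Q}(\sqrt{m})$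 is a quadratic subfield of $K$. If $m$ is square-free then $a$ is odd and $m\equiv 1\pmod 4$, so $(1,\omega)$ is an integral basis of $M$. *)

theory Defs
  imports
    "HOL-Computational_Algebra.Computational_Algebra"
    "HOL.Complex"
begin

text \<open>Number fields are taken as subfields of \<open>\<complex>\<close>.\<close>

global_interpretation rat_cx: vector_space "\<lambda>(q::rat) (z::complex). of_rat q * z"
  by unfold_locales (auto simp: of_rat_add of_rat_mult algebra_simps)

global_interpretation int_cx: module "\<lambda>(k::int) (z::complex). of_int k * z"
  by unfold_locales (auto simp: algebra_simps)

definition is_subfield :: "complex set \<Rightarrow> bool" where
  "is_subfield F \<longleftrightarrow>
     0 \<in> F \<and> 1 \<in> F \<and>
     (\<forall>x\<in>F. \<forall>y\<in>F. x + y \<in> F \<and> x * y \<in> F) \<and>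
     (\<forall>x\<in>F. - x \<in> F \<and> inverse x \<in> F)"

definition adjoin :: "complex \<Rightarrow> complex set"  (\<open>\<rat>'(_')\<close>) where
  "\<rat>(\<alpha>) = is_subfield hull {\<alpha>}"

definition field_degree :: "complex set \<Rightarrow> nat" where
  "field_degree K = rat_cx.dim K"

definition ring_of_integers :: "complex set \<Rightarrow> complex set" where
  "ring_of_integers K = {x \<in> K. algebraic_int x}"

text \<open>The basis is a tuple: without \<open>distinct\<close>, repeated entries would be lost in \<open>set bs\<close>.\<close>

definition int_basis :: "complex list \<Rightarrow> complex set \<Rightarrow> bool" where
  "int_basis bs M \<longleftrightarrow>
     distinct bs \<and> int_cx.independent (set bs) \<and> int_cx.span (set bs) = M"

text \<open>To be read for number fields \<open>K\<close> only (\<open>field_degree K\<close> is \<open>0\<close> for infinite extensions of \<open>\<rat>\<close>).\<close>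

definition generates_power_integral_basis :: "complex \<Rightarrow> complex set \<Rightarrow> bool" where
  "generates_power_integral_basis \<xi> K \<longleftrightarrow>
     \<xi> \<in> ring_of_integers K \<and>
     int_basis (map (\<lambda>i. \<xi> ^ i) [0..<field_degree K]) (ring_of_integers K)"

text \<open>The condition on a root does not depend on its choice, since the roots of an
  irreducible polynomial are conjugate.\<close>

definition monogenic :: "int poly \<Rightarrow> bool" where
  "monogenic f \<longleftrightarrow>
     lead_coeff f = 1 \<and> irreducible (map_poly of_int f :: rat poly) \<and>
     (\<exists>\<xi>::complex. poly (map_poly of_int f) \<xi> = 0 \<and> generates_power_integral_basis \<xi> (\<rat>(\<xi>)))"

definition even_recip_octic :: "int \<Rightarrow> int \<Rightarrow> int poly" where
  "even_recip_octic a b = [:1, 0, a, 0, b, 0, a, 0, 1:]"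

lemma even_recip_octic_eq:
  "even_recip_octic a b =
     monom 1 8 + monom a 6 + monom b 4 + monom a 2 + 1"
  by (simp add: even_recip_octic_def monom_altdef eval_nat_numeral one_pCons)

text \<open>Every root \<open>\<alpha>\<close> satisfies \<open>(2\<delta> + a)\<^sup>2 = m\<close>, so \<open>2\<delta> + a\<close> is a square root of \<open>m\<close>.\<close>

lemma sqrt_disc:
  fixes \<alpha> :: complex
  assumes "poly (map_poly of_int (even_recip_octic a b)) \<alpha> = 0"
  shows "(2 * (\<alpha>\<^sup>2 + \<alpha> powi (-2)) + of_int a)\<^sup>2 = of_int (a\<^sup>2 - 4 * b + 8)"
proof -
  have r: "\<alpha> ^ 8 + of_int a * \<alpha> ^ 6 + of_int b * \<alpha> ^ 4 + of_int a * \<alpha>\<^sup>2 + 1 = 0"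
    using assms by (simp add: even_recip_octic_def map_poly_pCons eval_nat_numeral algebra_simps)
  then have nz: "\<alpha> \<noteq> 0" by auto
  define \<beta> where "\<beta> = inverse \<alpha> ^ 2"
  have ab: "\<alpha>\<^sup>2 * \<beta> = 1" using nz by (simp add: \<beta>_def field_simps)
  have r': "(\<alpha>\<^sup>2)^4 + of_int a * (\<alpha>\<^sup>2)^3 + of_int b * (\<alpha>\<^sup>2)^2 + of_int a * \<alpha>\<^sup>2 + 1 = 0"
    using r by simp
  have "(2 * (\<alpha>\<^sup>2 + \<beta>) + of_int a)\<^sup>2 = (of_int a)\<^sup>2 - 4 * of_int b + 8"
    using ab r' by algebra
  then show ?thesis by (simp add: \<beta>_def power_int_minus power_inverse)
qed

end

theory Submission
  imports Defs "HOL-Computational_Algebra.Field_as_Ring"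
begin

text \<open>Since \<open>\<gamma> = -\<delta>\<alpha> + \<alpha>\<^sup>3 = -1/\<alpha>\<close> and \<open>f\<close> is even and reciprocal, \<open>\<gamma>\<close> is again a root of
  \<open>f\<close>, and \<open>\<rat>(\<gamma>) = \<rat>(\<alpha>)\<close>. The property of generating a power integral basis carries over from
  one root of an irreducible polynomial to any other, because for rational polynomials \<open>q\<close> both the
  vanishing and the integrality of \<open>q(\<xi>)\<close> depend only on \<open>q\<close> and \<open>f\<close>.\<close>

section \<open>Spans and independence of finite indexed families\<close>

lemma (in module) span_image_inj:
  assumes "finite A" "inj_on f A"
  shows "span (f ` A) = range (\<lambda>c. \<Sum>i\<in>A. scale (c i) (f i))"
proof -
  have "(\<Sum>v\<in>f ` A. scale (u v) v) = (\<Sum>i\<in>A. scale (u (f i)) (f i))" for u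
    using assms by (simp add: sum.reindex)
  moreover have "\<exists>u. (\<Sum>i\<in>A. scale (c i) (f i)) = (\<Sum>i\<in>A. scale (u (f i)) (f i))" for c
    \<comment> \<open>The coefficient of a vector is that of its index, unique by
      injectivity.\<close>
    by (rule exI[of _ "\<lambda>v. c (inv_into A f v)"]) (use assms in \<open>auto intro!: sum.cong\<close>)
  ultimately show ?thesis
    unfolding span_finite[OF finite_imageI[OF assms(1)]] by (auto simp: image_iff)
qed

lemma (in module) independent_image_inj:
  assumes "finite A" "inj_on f A"
    and "\<And>c i. (\<Sum>i\<in>A. scale (c i) (f i)) = 0 \<Longrightarrow> i \<in> A \<Longrightarrow> c i = 0"
  shows "independent (f ` A)"
proof -
  have "(\<Sum>v\<in>f ` A. scale (u v) v) = (\<Sum>i\<in>A. scale (u (f i)) (f i))" for u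
    using assms by (simp add: sum.reindex)
  then show ?thesis
    using assms(3)[of "u \<circ> f" for u] assms(1) by (auto simp: dependent_finite)
qed

subsection \<open>Evaluating rational polynomials\<close>

text \<open>Coefficients stay in \<open>rat\<close> while the argument is complex, so that
  divisibility and Bezout identities of \<open>rat poly\<close> can be used and then
  evaluated.\<close>

definition rpoly :: "rat poly \<Rightarrow> complex \<Rightarrow> complex" where
  "rpoly q z = poly (map_poly of_rat q) z"

lemma rpoly_0 [simp]: "rpoly 0 z = 0"
  by (simp add: rpoly_def)

lemma rpoly_pCons [simp]: "rpoly (pCons c q) z = of_rat c + z * rpoly q z"
  by (simp add: rpoly_def map_poly_pCons)

lemma rpoly_1 [simp]: "rpoly 1 z = 1"
  by (simp add: one_pCons)

lemma rpoly_add [simp]: "rpoly (p + q) z = rpoly p z + rpoly q z"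
  by (induction p q rule: poly_induct2) (simp_all add: of_rat_add algebra_simps)

lemma rpoly_minus [simp]: "rpoly (- q) z = - rpoly q z"
  using rpoly_add[of q "- q" z] by (simp add: eq_neg_iff_add_eq_0 add.commute)

lemma rpoly_diff [simp]: "rpoly (p - q) z = rpoly p z - rpoly q z"
  using rpoly_add[of p "- q" z] by simp

lemma rpoly_smult [simp]: "rpoly (smult c q) z = of_rat c * rpoly q z"
  by (induction q) (simp_all add: of_rat_mult algebra_simps)

lemma rpoly_mult [simp]: "rpoly (p * q) z = rpoly p z * rpoly q z"
  by (induction p) (simp_all add: algebra_simps)

lemma rpoly_pcompose [simp]: "rpoly (pcompose p q) z = rpoly p (rpoly q z)"
  by (induction p) (simp_all add: pcompose_pCons)

lemma rpoly_monom [simp]: "rpoly (monom c n) z = of_rat c * z ^ n"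
  by (simp add: rpoly_def map_poly_monom poly_monom)

lemma rpoly_sum: "rpoly (\<Sum>i\<in>A. q i) z = (\<Sum>i\<in>A. rpoly (q i) z)"
  by (induction A rule: infinite_finite_induct) simp_all

lemma rpoly_of_int: "rpoly (map_poly of_int h) z = poly (map_poly of_int h) z"
  by (simp add: rpoly_def map_poly_map_poly o_def)

text \<open>Casts integrality as the vanishing of a rational polynomial, the form in which it can be
  moved between roots.\<close>

lemma algebraic_int_iff_rpoly:
  "algebraic_int z \<longleftrightarrow> (\<exists>h. rpoly (map_poly of_int h) z = 0 \<and> lead_coeff h = 1)"
  by (simp add: algebraic_int_altdef_ipoly rpoly_of_int)

subsection \<open>Simple extensions\<close>

lemma is_subfield_adjoin: "is_subfield (\<rat>(z))"
  unfolding adjoin_def by (rule hull_in) (fastforce simp: is_subfield_def)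

lemma self_mem_adjoin: "z \<in> \<rat>(z)"
  unfolding adjoin_def by (simp add: hull_inc)

lemma adjoin_subset: "is_subfield F \<Longrightarrow> z \<in> F \<Longrightarrow> \<rat>(z) \<subseteq> F"
  unfolding adjoin_def by (simp add: hull_minimal)

lemma adjoin_neg_inverse: "\<rat>(- inverse z) = \<rat>(z)"
proof
  show "\<rat>(- inverse z) \<subseteq> \<rat>(z)"
    using is_subfield_adjoin[of z] self_mem_adjoin[of z]
    by (intro adjoin_subset) (auto simp: is_subfield_def)
  \<comment> \<open>Sending \<open>z\<close> to \<open>- inverse z\<close> is an involution, so the
    inclusion just shown can be reversed.\<close>
  have "- inverse (- inverse z) \<in> \<rat>(- inverse z)"
    using is_subfield_adjoin[of "- inverse z"] self_mem_adjoin[of "- inverse z"]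
    unfolding is_subfield_def by blast
  then show "\<rat>(z) \<subseteq> \<rat>(- inverse z)"
    by (intro adjoin_subset is_subfield_adjoin) simp
qed

lemma subfield_of_int:
  assumes "is_subfield F"
  shows "of_int k \<in> F"
proof -
  have "of_nat n \<in> F" for n
    using assms by (induction n) (auto simp: is_subfield_def)
  then show ?thesis
    using assms by (cases k) (auto simp: is_subfield_def simp del: of_nat_Suc)
qed

lemma subfield_of_rat:
  assumes "is_subfield F"
  shows "of_rat q \<in> F"
  using assms subfield_of_int[OF assms]
  by (cases q) (auto simp: of_rat_rat is_subfield_def divide_inverse)

lemma subfield_rpoly:
  assumes "is_subfield F" "z \<in> F"
  shows "rpoly q z \<in> F"
  using assms subfield_of_rat[OF assms(1)]
  by (induction q) (auto simp: is_subfield_def)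

section \<open>Roots of irreducible rational polynomials\<close>

locale irreducible_root =
  fixes p :: "rat poly" and z :: complex
  assumes irred: "irreducible p" and root: "rpoly p z = 0"
begin

text \<open>The irreducible \<open>p\<close> is coprime to \<open>q\<close>; evaluating a Bezout
  identity at \<open>z\<close> kills the term with \<open>p\<close>.\<close>

lemma rpoly_bezout:
  assumes "\<not> p dvd q"
  shows "\<exists>r. rpoly r z * rpoly q z = 1"
proof -
  have "coprime p q"
    using irred assms by (simp add: prime_elem_imp_coprime irreducible_imp_prime_elem)
  then have "fst (bezout_coefficients p q) * p + snd (bezout_coefficients p q) * q = 1"
    by (simp add: bezout_coefficients_fst_snd)
  then have "rpoly (fst (bezout_coefficients p q) * p + snd (bezout_coefficients p q) * q) z = 1"
    by simp
  then show ?thesis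
    using root by auto
qed

text \<open>An invertible value is nonzero. Since \<open>p dvd q\<close> does not mention
  \<open>z\<close>, all roots of \<open>p\<close> annihilate the same polynomials.\<close>

lemma rpoly_eq_0_iff: "rpoly q z = 0 \<longleftrightarrow> p dvd q"
  by (cases "p dvd q") (use rpoly_bezout[of q] root in auto)

lemma rpoly_eq_0_small:
  assumes "rpoly q z = 0" "degree q < degree p"
  shows "q = 0"
  using assms rpoly_eq_0_iff dvd_imp_degree_le[of p q] by fastforce

lemma degree_pos: "degree p > 0"
proof (rule ccontr)
  assume "\<not> degree p > 0"
  then have "is_unit p"
    using irred by (auto simp: is_unit_iff_degree irreducible_def)
  then show False
    using irred by (simp add: irreducible_def)
qed

text \<open>The values of polynomials at \<open>z\<close> are already closed under inverses, by the
  Bezout identity.\<close>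

lemma adjoin_eq: "\<rat>(z) = range (\<lambda>q. rpoly q z)"
proof
  have "is_subfield (range (\<lambda>q. rpoly q z))"
    unfolding is_subfield_def
  proof (intro conjI ballI)
    show "0 \<in> range (\<lambda>q. rpoly q z)" "1 \<in> range (\<lambda>q. rpoly q z)"
      by (auto intro: range_eqI[of _ _ 0] range_eqI[of _ _ 1])
  next
    fix x y assume "x \<in> range (\<lambda>q. rpoly q z)" "y \<in> range (\<lambda>q. rpoly q z)"
    then show "x + y \<in> range (\<lambda>q. rpoly q z)" "x * y \<in> range (\<lambda>q. rpoly q z)"
      by (auto simp flip: rpoly_add rpoly_mult)
  next
    fix x assume "x \<in> range (\<lambda>q. rpoly q z)"
    then obtain q where x: "x = rpoly q z" by auto
    then show "- x \<in> range (\<lambda>q. rpoly q z)"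
      by (auto simp flip: rpoly_minus)
    show "inverse x \<in> range (\<lambda>q. rpoly q z)"
    proof (cases "p dvd q")
      case True
      then have "x = 0" using x rpoly_eq_0_iff by simp
      \<comment> \<open>Here \<open>inverse 0 = 0\<close> is the value of the zero
        polynomial.\<close>
      then show ?thesis by (auto intro: range_eqI[of _ _ 0])
    next
      case False
      then obtain r where "rpoly r z * x = 1" using rpoly_bezout x by blast
      then have "inverse x = rpoly r z"
        by (metis inverse_unique mult.commute)
      then show ?thesis by auto
    qed
  qed
  moreover have "z \<in> range (\<lambda>q. rpoly q z)"
    by (rule range_eqI[of _ _ "[:0, 1:]"]) simp
  ultimately show "\<rat>(z) \<subseteq> range (\<lambda>q. rpoly q z)"
    by (rule adjoin_subset)
  show "range (\<lambda>q. rpoly q z) \<subseteq> \<rat>(z)"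
    using subfield_rpoly[OF is_subfield_adjoin self_mem_adjoin] by auto
qed

text \<open>A relation is a polynomial of degree below \<open>degree p\<close> that vanishes at
  \<open>z\<close>, hence zero.\<close>

lemma rational_relation_trivial:
  assumes "(\<Sum>i<degree p. of_rat (c i) * z ^ i) = 0" "i < degree p"
  shows "c i = 0"
proof -
  let ?q = "\<Sum>i<degree p. monom (c i) i"
  have "degree ?q < degree p"
    using degree_pos by (intro degree_sum_less) (auto intro: le_less_trans[OF degree_monom_le])
  moreover have "rpoly ?q z = 0"
    using assms by (simp add: rpoly_sum)
  ultimately have "?q = 0"
    by (rule rpoly_eq_0_small[rotated])
  then have "coeff ?q i = 0"
    by (simp only: coeff_0)
  then show ?thesis
    using assms(2) by (simp add: coeff_sum)
qed

lemma inj_on_powers: "inj_on (\<lambda>i. z ^ i) {..<degree p}"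
proof (rule inj_onI)
  fix i j assume ij: "i \<in> {..<degree p}" "j \<in> {..<degree p}" "z ^ i = z ^ j"
  then have "rpoly (monom 1 i - monom 1 j) z = 0" by simp
  moreover have "degree (monom 1 i - monom 1 j :: rat poly) < degree p"
    using ij by (intro degree_diff_less) (auto simp: degree_monom_eq)
  ultimately have "monom 1 i - monom 1 j = (0 :: rat poly)"
    by (rule rpoly_eq_0_small)
  then show "i = j"
    by (metis degree_monom_eq one_neq_zero right_minus_eq)
qed

text \<open>The powers of \<open>z\<close> below \<open>degree p\<close> form a basis; they span
  because the remainder modulo \<open>p\<close> has the same value at \<open>z\<close>.\<close>

lemma field_degree_eq: "field_degree (\<rat>(z)) = degree p"
proof -
  let ?B = "(\<lambda>i. z ^ i) ` {..<degree p}"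
  have span: "rat_cx.span ?B = range (\<lambda>c. \<Sum>i<degree p. of_rat (c i) * z ^ i)"
    using inj_on_powers by (simp add: rat_cx.span_image_inj)
  have "rat_cx.dim (\<rat>(z)) = degree p"
  proof (rule rat_cx.dim_unique)
    show "?B \<subseteq> \<rat>(z)"
      using adjoin_eq by (auto intro: range_eqI[of _ _ "monom 1 i" for i])
    show "rat_cx.independent ?B"
      using inj_on_powers rational_relation_trivial by (intro rat_cx.independent_image_inj) auto
    show "card ?B = degree p"
      using inj_on_powers by (simp add: card_image)
    show "\<rat>(z) \<subseteq> rat_cx.span ?B"
    proof
      fix x assume "x \<in> \<rat>(z)"
      then obtain q where "x = rpoly q z" using adjoin_eq by auto
      moreover define r where "r = q mod p"
      moreover have "rpoly q z = rpoly (q div p * p + q mod p) z" by simp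
      ultimately have x: "x = rpoly r z"
        using root unfolding rpoly_add rpoly_mult by simp
      have "degree r < degree p"
        using degree_pos degree_mod_less[of p q] irred by (cases "p = 0") (auto simp: r_def)
      \<comment> \<open>The monomial expansion includes its upper bound, hence
        \<open>degree p - 1\<close>.\<close>
      then have "r = (\<Sum>i<degree p. monom (coeff r i) i)"
        using poly_as_sum_of_monoms'[of r "degree p - 1"] degree_pos
        by (metis Suc_pred' lessThan_Suc_atMost less_Suc_eq_le)
      then have "x = (\<Sum>i<degree p. of_rat (coeff r i) * z ^ i)"
        unfolding x by (metis (no_types, lifting) rpoly_monom rpoly_sum sum.cong)
      then show "x \<in> rat_cx.span ?B" unfolding span by blast
    qed
  qed
  then show ?thesis by (simp add: field_degree_def)
qed

text \<open>The powers are distinct and independent for every root, so besides integrality of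
  \<open>z\<close> only the equality of span and ring of integers remains; it is tested on each
  value \<open>rpoly q z\<close>.\<close>

lemma generates_power_integral_basis_iff:
  "generates_power_integral_basis z (\<rat>(z)) \<longleftrightarrow>
     algebraic_int z \<and>
     (\<forall>q. algebraic_int (rpoly q z) \<longleftrightarrow> (\<exists>c. rpoly q z = (\<Sum>i<degree p. of_int (c i) * z ^ i)))"
proof -
  let ?bs = "map (\<lambda>i. z ^ i) [0..<degree p]"
  have bs: "set ?bs = (\<lambda>i. z ^ i) ` {..<degree p}" by (auto simp: lessThan_atLeast0)
  have dist: "distinct ?bs"
    using inj_on_powers by (simp add: distinct_map lessThan_atLeast0)
  have indep: "int_cx.independent (set ?bs)"
    unfolding bs
    using inj_on_powers rational_relation_trivial[of "\<lambda>i. of_int (c i)" for c]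
    by (intro int_cx.independent_image_inj) auto
  have span: "int_cx.span (set ?bs) = range (\<lambda>c. \<Sum>i<degree p. of_int (c i) * z ^ i)"
    unfolding bs using inj_on_powers by (simp add: int_cx.span_image_inj)
  have "(\<Sum>i<degree p. of_int (c i) * z ^ i) = rpoly (\<Sum>i<degree p. monom (of_int (c i)) i) z" for c
    by (simp add: rpoly_sum)
  then have sub: "range (\<lambda>c. \<Sum>i<degree p. of_int (c i) * z ^ i) \<subseteq> range (\<lambda>q. rpoly q z)"
    by auto
  \<comment> \<open>Both sets consist of values \<open>g q\<close>, so they can be compared value by
    value.\<close>
  have eq_iff: "S = {x \<in> range g. P x} \<longleftrightarrow> (\<forall>q. P (g q) \<longleftrightarrow> g q \<in> S)"
    if "S \<subseteq> range g" for S P and g :: "rat poly \<Rightarrow> complex"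
    using that by blast
  have "z \<in> ring_of_integers (\<rat>(z)) \<longleftrightarrow> algebraic_int z"
    by (simp add: ring_of_integers_def self_mem_adjoin)
  moreover have "int_cx.span (set ?bs) = ring_of_integers (\<rat>(z)) \<longleftrightarrow>
    (\<forall>q. algebraic_int (rpoly q z) \<longleftrightarrow> (\<exists>c. rpoly q z = (\<Sum>i<degree p. of_int (c i) * z ^ i)))"
    unfolding span ring_of_integers_def adjoin_eq eq_iff[OF sub]
    by (simp only: image_iff Bex_def UNIV_I simp_thms)
  ultimately show ?thesis
    using dist indep
    by (simp add: generates_power_integral_basis_def int_basis_def field_degree_eq)
qed

end

section \<open>Passage to a conjugate root\<close>

lemma generates_power_integral_basis_conjugate:
  assumes "irreducible p" "rpoly p \<xi> = 0" "rpoly p \<zeta> = 0"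
    and "generates_power_integral_basis \<xi> (\<rat>(\<xi>))"
  shows "generates_power_integral_basis \<zeta> (\<rat>(\<zeta>))"
proof -
  interpret \<xi>: irreducible_root p \<xi> using assms by unfold_locales
  interpret \<zeta>: irreducible_root p \<zeta> using assms by unfold_locales
  have zero: "rpoly q \<zeta> = 0 \<longleftrightarrow> rpoly q \<xi> = 0" for q
    using \<xi>.rpoly_eq_0_iff \<zeta>.rpoly_eq_0_iff by simp
  \<comment> \<open>Composing a monic integer polynomial with \<open>q\<close> reduces integrality
    of the value to \<open>zero\<close>.\<close>
  have alg: "algebraic_int (rpoly q \<zeta>) \<longleftrightarrow> algebraic_int (rpoly q \<xi>)" for q
    using zero[of "pcompose _ q"] by (simp add: algebraic_int_iff_rpoly)
  have comb: "rpoly q \<zeta> = (\<Sum>i<degree p. of_int (c i) * \<zeta> ^ i) \<longleftrightarrow>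
      rpoly q \<xi> = (\<Sum>i<degree p. of_int (c i) * \<xi> ^ i)" for q c
    using zero[of "q - (\<Sum>i<degree p. monom (of_int (c i)) i)"] by (simp add: rpoly_sum)
  \<comment> \<open>The polynomial \<open>[:0, 1:]\<close> gives integrality of
    \<open>\<zeta>\<close> itself.\<close>
  show ?thesis
    using assms(4) alg[of "[:0, 1:]"]
    by (simp add: \<xi>.generates_power_integral_basis_iff \<zeta>.generates_power_integral_basis_iff alg comb)
qed

text \<open>\<open>monogenic\<close> provides only some good root; conjugacy carries the property to
  \<open>\<zeta>\<close>.\<close>

lemma monogenic_root:
  assumes "monogenic f" "poly (map_poly of_int f) \<zeta> = 0"
  shows "generates_power_integral_basis \<zeta> (\<rat>(\<zeta>))"
  using assms generates_power_integral_basis_conjugate[of "map_poly of_int f"]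
  by (auto simp: monogenic_def rpoly_of_int)

section \<open>The even reciprocal octic\<close>

lemma poly_even_recip_octic:
  "poly (map_poly of_int (even_recip_octic a b)) z =
     z ^ 8 + of_int a * z ^ 6 + of_int b * z ^ 4 + of_int a * z\<^sup>2 + (1 :: complex)"
  by (simp add: even_recip_octic_def map_poly_pCons eval_nat_numeral algebra_simps)

theorem theorem6:
  fixes a b m :: int and \<alpha> \<delta> sqrt_m \<omega> \<gamma> :: complex
  assumes "monogenic (even_recip_octic a b)"
    and "poly (map_poly of_int (even_recip_octic a b)) \<alpha> = 0"
    and "m = a\<^sup>2 - 4 * b + 8" and "m < 0" and "squarefree m"
    and "\<delta> = \<alpha>\<^sup>2 + \<alpha> powi (-2)"
    and "sqrt_m = 2 * \<delta> + of_int a"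
    and "\<omega> = (1 + sqrt_m) / 2"
    and "\<gamma> = ((of_int a + 1) / 2 - \<omega>) * \<alpha> + \<alpha> ^ 3"
  shows "generates_power_integral_basis \<gamma> (\<rat>(\<alpha>))"
proof -
  have root: "\<alpha> ^ 8 + of_int a * \<alpha> ^ 6 + of_int b * \<alpha> ^ 4 + of_int a * \<alpha>\<^sup>2 + 1 = 0"
    using assms(2) by (simp add: poly_even_recip_octic)
  then have nz: "\<alpha> \<noteq> 0" by auto
  define \<beta> where "\<beta> = inverse \<alpha>"
  have ab: "\<alpha> * \<beta> = 1" using nz by (simp add: \<beta>_def)
  have "\<delta> = \<alpha>\<^sup>2 + \<beta>\<^sup>2"
    using assms(6) by (simp add: \<beta>_def power_int_minus power_inverse)
  \<comment> \<open>Substituting \<open>sqrt_m\<close> turns the factor of \<open>\<alpha>\<close>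
    into \<open>- \<delta>\<close>.\<close>
  moreover have "\<gamma> = - \<delta> * \<alpha> + \<alpha> ^ 3"
    by (simp add: assms(7-9) field_simps)
  ultimately have "\<gamma> = - \<beta>"
    using ab by algebra
  \<comment> \<open>Multiply \<open>root\<close> by \<open>\<beta> ^ 8\<close>: the coefficients are
    palindromic.\<close>
  moreover have "\<beta> ^ 8 + of_int a * \<beta> ^ 6 + of_int b * \<beta> ^ 4 + of_int a * \<beta>\<^sup>2 + 1 = 0"
    using ab root by algebra
  \<comment> \<open>Only even powers occur, so the sign of \<open>- \<beta>\<close>
    disappears.\<close>
  ultimately have "poly (map_poly of_int (even_recip_octic a b)) \<gamma> = 0"
    by (simp add: poly_even_recip_octic)
  then have "generates_power_integral_basis \<gamma> (\<rat>(\<gamma>))"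
    using assms(1) monogenic_root by blast
  then show ?thesis
    using \<open>\<gamma> = - \<beta>\<close> by (simp add: \<beta>_def adjoin_neg_inverse)
qed

end
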